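(* Every topologically mixing continuous action of an infinite group $G$ on a Hausdorff uniform space $X$ that is not reduced to a single point is sensitive.
   Context: A uniform space is a set $X$ equipped with a uniform structure $\mathcal{U}$ (in the sense of Weil), whose elements, which are subsets of $X \times X$, are called entourages. $X$ carries the induced topology, for which the neighborhoods of $x \in X$ are the sets $U[x] = \{y \in X : (x,y) \in U\}$, $U \in \mathcal{U}$. "Hausdorff" refers to this topology. $G$ is an abstract group with no topology. Continuous action: for each $g \in G$, the map $x \mapsto gx$ is continuous on $X$. Topologically mixing action: for any two non-empty open subsets $V, W$ of $X$, there exists a finite subset $K \subset G$ such that $gV \cap W \neq \varnothing$ for all $g \in G \setminus K$. Sensitive action: there is an entourage $U \in \mathcal{U}$ such that, for all $x \in X$ and every neighborhood $N$ of $x$, there exist a point $y \in N$ and an element $g \in G$ such that $(gx, gy) \notin U$. *)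

theory Defs
  imports Complex_Main "HOL-Algebra.Group_Action"
begin

text \<open>
  The space \<open>X\<close> is a whole type of class \<^class>\<open>uniform_space\<close>. The library presents the uniform
  structure as a filter on pairs, whose members are the entourages; the class axioms make the
  topology of the type the one induced by it.
\<close>

definition entourage :: "('x::uniform_space \<times> 'x) set \<Rightarrow> bool" where
  "entourage U \<longleftrightarrow> eventually (\<lambda>p. p \<in> U) uniformity"

definition continuous_action ::
    "('g, 'm) monoid_scheme \<Rightarrow> ('g \<Rightarrow> 'x \<Rightarrow> 'x::topological_space) \<Rightarrow> bool" where
  "continuous_action G \<phi> \<longleftrightarrow>
     group_action G UNIV \<phi> \<and> (\<forall>g\<in>carrier G. continuous_on UNIV (\<phi> g))"

definition topologically_mixing ::
    "('g, 'm) monoid_scheme \<Rightarrow> ('g \<Rightarrow> 'x \<Rightarrow> 'x::topological_space) \<Rightarrow> bool" where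
  "topologically_mixing G \<phi> \<longleftrightarrow>
     (\<forall>V W. open V \<and> V \<noteq> {} \<and> open W \<and> W \<noteq> {} \<longrightarrow>
       (\<exists>K. finite K \<and> K \<subseteq> carrier G \<and> (\<forall>g\<in>carrier G - K. \<phi> g ` V \<inter> W \<noteq> {})))"

text \<open>Neighborhoods are arbitrary members of the neighborhood filter, not only the open ones.\<close>

definition sensitive ::
    "('g, 'm) monoid_scheme \<Rightarrow> ('g \<Rightarrow> 'x \<Rightarrow> 'x::uniform_space) \<Rightarrow> bool" where
  "sensitive G \<phi> \<longleftrightarrow>
     (\<exists>U. entourage U \<and>
       (\<forall>x N. eventually (\<lambda>y. y \<in> N) (nhds x) \<longrightarrow>
         (\<exists>y\<in>N. \<exists>g\<in>carrier G. (\<phi> g x, \<phi> g y) \<notin> U)))"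

end

theory Submission
  imports Defs
begin

text \<open>
  Fix points \<open>a \<noteq> b\<close> and a symmetric entourage \<open>D\<close> with \<open>(a, b) \<notin> D\<circ>D\<circ>D\<circ>D\<close>. By mixing, a single
  \<open>g\<close> moves points \<open>v\<close>, \<open>w\<close> of a given open neighborhood of \<open>x\<close> to points \<open>D\<close>-close to \<open>a\<close> and \<open>b\<close>
  respectively, since only finitely many elements of the infinite group \<open>G\<close> are excluded.
  Then \<open>gx\<close> cannot be \<open>D\<close>-close to both \<open>gv\<close> and \<open>gw\<close>.
\<close>

text \<open>The T1 axiom gives an open \<open>S\<close> around \<open>a\<close> that misses
  \<open>b\<close>. Openness of \<open>S\<close> at \<open>a\<close> is itself a statement about the
  uniformity, and the entourage it provides excludes \<open>(a, b)\<close>.\<close>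

lemma uniformity_separates:
  fixes a b :: "'x::{uniform_space, t1_space}"
  assumes "a \<noteq> b"
  obtains E where "eventually E uniformity" "\<not> E (a, b)"
proof -
  obtain S where "open S" "a \<in> S" "b \<notin> S"
    using assms t1_space by blast
  then show thesis
    using that[of "\<lambda>(x', y). x' = a \<longrightarrow> y \<in> S"] by (auto simp: open_uniformity)
qed

text \<open>Intersecting a half of \<open>E\<close> with its converse makes it symmetric and only
  shrinks it, so it remains a half of \<open>E\<close>.\<close>

lemma uniformity_sym_transE:
  fixes E :: "'x::uniform_space \<times> 'x \<Rightarrow> bool"
  assumes "eventually E uniformity"
  obtains D where "eventually D uniformity" "\<And>x y. D (x, y) \<Longrightarrow> D (y, x)"
    "\<And>x y z. D (x, y) \<Longrightarrow> D (y, z) \<Longrightarrow> E (x, z)"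
proof -
  obtain D where D: "eventually D uniformity"
      "\<And>x y z. D (x, y) \<Longrightarrow> D (y, z) \<Longrightarrow> E (x, z)"
    by (rule uniformity_transE[OF assms]) metis
  have "eventually (\<lambda>(x, y). D (x, y) \<and> D (y, x)) uniformity"
    using eventually_conj[OF D(1) uniformity_sym[OF D(1)]] by (simp add: case_prod_beta')
  then show thesis
    using that[of "\<lambda>(x, y). D (x, y) \<and> D (y, x)"] D(2) by auto
qed

lemma open_in_entourage_ball:
  fixes a :: "'x::uniform_space"
  assumes "eventually D uniformity"
  shows "\<exists>S. open S \<and> a \<in> S \<and> (\<forall>y\<in>S. D (a, y))"
proof -
  \<comment> \<open>The guard \<open>x' = a\<close> is the form in which the uniformity describes
    \<open>nhds a\<close>.\<close>
  have "eventually (\<lambda>(x', y). x' = a \<longrightarrow> D (a, y)) uniformity"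
    using assms by (rule eventually_mono) auto
  then have "eventually (\<lambda>y. D (a, y)) (nhds a)"
    by (simp add: eventually_nhds_uniformity)
  then show ?thesis
    by (simp add: eventually_nhds)
qed

theorem theorem1p3:
  fixes G :: "('g, 'm) monoid_scheme"
    and \<phi> :: "'g \<Rightarrow> 'x \<Rightarrow> 'x::{uniform_space, t2_space}"
  assumes "group G"
    and "infinite (carrier G)"
    and "\<not> (\<exists>x::'x. UNIV = {x})"
    and "continuous_action G \<phi>"
    and "topologically_mixing G \<phi>"
  shows "sensitive G \<phi>"
proof -
  obtain a b :: 'x where "a \<noteq> b"
    using assms(3) by blast
  then obtain E where E: "eventually E uniformity" "\<not> E (a, b)"
    by (rule uniformity_separates)
  \<comment> \<open>\<open>E\<close> is halved twice because the chain from \<open>a\<close> to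
    \<open>b\<close> has four links, through \<open>\<phi> g v\<close>, \<open>\<phi> g x\<close>
    and \<open>\<phi> g w\<close>. Only the finer half \<open>D\<close> has links to
    reverse.\<close>
  obtain F where F: "eventually F uniformity" "\<And>x y z. F (x, y) \<Longrightarrow> F (y, z) \<Longrightarrow> E (x, z)"
    by (rule uniformity_transE[OF E(1)]) metis
  obtain D where D: "eventually D uniformity" "\<And>x y. D (x, y) \<Longrightarrow> D (y, x)"
      "\<And>x y z. D (x, y) \<Longrightarrow> D (y, z) \<Longrightarrow> F (x, z)"
    by (rule uniformity_sym_transE[OF F(1)]) metis
  obtain A where A: "open A" "a \<in> A" "\<forall>y\<in>A. D (a, y)"
    using open_in_entourage_ball[OF D(1), of a] by auto
  obtain B where B: "open B" "b \<in> B" "\<forall>y\<in>B. D (b, y)"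
    using open_in_entourage_ball[OF D(1), of b] by auto
  have mixing: "\<exists>K. finite K \<and> (\<forall>g\<in>carrier G - K. \<phi> g ` V \<inter> W \<noteq> {})"
    if "open V" "V \<noteq> {}" "open W" "W \<noteq> {}" for V W
    using assms(5) that unfolding topologically_mixing_def by meson
  have "\<exists>y\<in>N. \<exists>g\<in>carrier G. \<not> D (\<phi> g x, \<phi> g y)"
    if N: "eventually (\<lambda>y. y \<in> N) (nhds x)" for x N
  proof -
    obtain V where V: "open V" "x \<in> V" "V \<subseteq> N"
      using N unfolding eventually_nhds by blast
    obtain K where K: "finite K" "\<forall>g\<in>carrier G - K. \<phi> g ` V \<inter> A \<noteq> {}"
      using mixing[of V A] V(1,2) A(1,2) by blast
    obtain L where L: "finite L" "\<forall>g\<in>carrier G - L. \<phi> g ` V \<inter> B \<noteq> {}"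
      using mixing[of V B] V(1,2) B(1,2) by blast
    \<comment> \<open>The same \<open>g\<close> must serve both targets \<open>A\<close> and
      \<open>B\<close>, so both exceptional sets are removed at once.\<close>
    have "infinite (carrier G - (K \<union> L))"
      using assms(2) K(1) L(1) by (simp add: Diff_infinite_finite)
    then obtain g where g: "g \<in> carrier G" "g \<notin> K" "g \<notin> L"
      using infinite_imp_nonempty[of "carrier G - (K \<union> L)"] by blast
    obtain v where v: "v \<in> V" "\<phi> g v \<in> A"
      using K(2) g by blast
    obtain w where w: "w \<in> V" "\<phi> g w \<in> B"
      using L(2) g by blast
    have "\<not> D (\<phi> g x, \<phi> g v) \<or> \<not> D (\<phi> g x, \<phi> g w)"
    proof (rule ccontr)
      assume "\<not> ?thesis"
      then have xv: "D (\<phi> g x, \<phi> g v)" and xw: "D (\<phi> g x, \<phi> g w)"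
        by simp_all
      have "F (a, \<phi> g x)"
        by (rule D(3)[OF bspec[OF A(3) v(2)] D(2)[OF xv]])
      moreover have "F (\<phi> g x, b)"
        by (rule D(3)[OF xw D(2)[OF bspec[OF B(3) w(2)]]])
      ultimately have "E (a, b)"
        by (rule F(2))
      then show False
        using E(2) by simp
    qed
    then show ?thesis
      using v(1) w(1) V(3) g(1) by blast
  qed
  \<comment> \<open>\<open>D\<close> was chosen before \<open>x\<close> and \<open>N\<close>, so it
    is a uniform witness of sensitivity.\<close>
  then show ?thesis
    unfolding sensitive_def entourage_def
    using D(1) by (intro exI[of _ "{p. D p}"]) simp
qed

end
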